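(* For any prime $p$, the projective plane $\mathbf{PG}(2,\overline{\mathbb{F}_p})$ does not admit Singer groups.
   Context: $\overline{\mathbb{F}_p}$ is an algebraic closure of the field with $p$ elements. For a field $\mathbb{F}$, $\mathbf{PG}(2,\mathbb{F})$ is the projective plane whose points and lines are the $1$- and $2$-dimensional subspaces of $\mathbb{F}^3$; its automorphism group is $\mathbf{P\Gamma L}_3(\mathbb{F})$ (semilinear bijections modulo scalars). A Singer group of a projective plane is a subgroup of its automorphism group that acts sharply transitively on its points (for any two points $x,y$ there is exactly one group element mapping $x$ to $y$). *)

theory Defs
  imports
    "HOL-Analysis.Cartesian_Space"
    "HOL-Algebra.Bij"
    "HOL-Algebra.Algebraic_Closure_Type"
begin

record ('p, 'l) incidence_structure =
  points :: "'p set"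
  lines :: "'l set"
  incident :: "'p \<Rightarrow> 'l \<Rightarrow> bool"

text \<open>
  In a projective plane a line is determined by the points on it, so an automorphism is
  determined by its action on the points. Automorphisms are therefore represented by point
  permutations which extend to the lines.
\<close>

definition automorphisms :: "('p, 'l) incidence_structure \<Rightarrow> ('p \<Rightarrow> 'p) set" where
  "automorphisms S = {f \<in> Bij (points S).
     \<exists>g. bij_betw g (lines S) (lines S) \<and>
         (\<forall>x\<in>points S. \<forall>l\<in>lines S. incident S (f x) (g l) \<longleftrightarrow> incident S x l)}"

definition automorphism_group :: "('p, 'l) incidence_structure \<Rightarrow> ('p \<Rightarrow> 'p) monoid" where
  "automorphism_group S = BijGroup (points S)\<lparr>carrier := automorphisms S\<rparr>"

lemma subgroup_automorphisms: "subgroup (automorphisms S) (BijGroup (points S))"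
proof -
  interpret group "BijGroup (points S)" by (rule group_BijGroup)
  show ?thesis
  proof (rule subgroupI)
    show "automorphisms S \<subseteq> carrier (BijGroup (points S))"
      by (auto simp: automorphisms_def BijGroup_def)
    have "(\<lambda>x\<in>points S. x) \<in> automorphisms S"
      unfolding automorphisms_def by (auto simp: id_Bij intro!: exI[of _ id])
    then show "automorphisms S \<noteq> {}" by blast
  next
    fix f assume "f \<in> automorphisms S"
    then obtain g where f: "f \<in> Bij (points S)" and g: "bij_betw g (lines S) (lines S)"
      and fg: "\<And>x l. x \<in> points S \<Longrightarrow> l \<in> lines S \<Longrightarrow> incident S (f x) (g l) \<longleftrightarrow> incident S x l"
      by (auto simp: automorphisms_def)
    have bf: "bij_betw f (points S) (points S)" using f by (simp add: Bij_def)
    have "incident S (inv_into (points S) f x) (inv_into (lines S) g l) \<longleftrightarrow> incident S x l"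
      if "x \<in> points S" "l \<in> lines S" for x l
    proof -
      have "inv_into (points S) f x \<in> points S" "f (inv_into (points S) f x) = x"
        using bij_betwE[OF bij_betw_inv_into[OF bf]] bij_betw_inv_into_right[OF bf] that by blast+
      moreover have "inv_into (lines S) g l \<in> lines S" "g (inv_into (lines S) g l) = l"
        using bij_betwE[OF bij_betw_inv_into[OF g]] bij_betw_inv_into_right[OF g] that by blast+
      ultimately show ?thesis using fg by metis
    qed
    then show "inv\<^bsub>BijGroup (points S)\<^esub> f \<in> automorphisms S"
      using f bij_betw_inv_into[OF g]
      by (auto simp: automorphisms_def inv_BijGroup restrict_inv_into_Bij
          intro!: exI[of _ "inv_into (lines S) g"])
  next
    fix f f' assume "f \<in> automorphisms S" "f' \<in> automorphisms S"
    then obtain g g' where f: "f \<in> Bij (points S)" "f' \<in> Bij (points S)"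
      and g: "bij_betw g (lines S) (lines S)" "bij_betw g' (lines S) (lines S)"
      and fg: "\<And>x l. x \<in> points S \<Longrightarrow> l \<in> lines S \<Longrightarrow> incident S (f x) (g l) \<longleftrightarrow> incident S x l"
        "\<And>x l. x \<in> points S \<Longrightarrow> l \<in> lines S \<Longrightarrow> incident S (f' x) (g' l) \<longleftrightarrow> incident S x l"
      by (auto simp: automorphisms_def)
    have "f' x \<in> points S" if "x \<in> points S" for x
      using Bij_imp_funcset[OF f(2)] that by blast
    moreover have "g' l \<in> lines S" if "l \<in> lines S" for l
      using g(2) that by (auto simp: bij_betw_def)
    ultimately have "compose (points S) f f' \<in> automorphisms S"
      using f compose_Bij[OF f] bij_betw_trans[OF g(2,1)] fg
      by (auto simp: automorphisms_def compose_def intro!: exI[of _ "g \<circ> g'"])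
    then show "f \<otimes>\<^bsub>BijGroup (points S)\<^esub> f' \<in> automorphisms S"
      using f by (simp add: BijGroup_def)
  qed
qed

lemma group_automorphism_group: "group (automorphism_group S)"
  unfolding automorphism_group_def
  by (rule subgroup.subgroup_is_group[OF subgroup_automorphisms group_BijGroup])

definition singer_group :: "('p, 'l) incidence_structure \<Rightarrow> ('p \<Rightarrow> 'p) set \<Rightarrow> bool" where
  "singer_group S G \<longleftrightarrow> subgroup G (automorphism_group S) \<and>
     (\<forall>x\<in>points S. \<forall>y\<in>points S. \<exists>!g. g \<in> G \<and> g x = y)"

definition PG2 :: "(('k::field ^ 3) set, ('k ^ 3) set) incidence_structure" where
  "PG2 = \<lparr>points = {V. vec.subspace V \<and> vec.dim V = 1},
          lines = {V. vec.subspace V \<and> vec.dim V = 2},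
          incident = (\<subseteq>)\<rparr>"

end

theory Submission
  imports Defs "HOL-Analysis.Determinants" "HOL-Number_Theory.Cong"
begin

text \<open>
Let \<open>K\<close> be an algebraic closure of the field with \<open>p\<close> elements and let \<open>G\<close> be a Singer group of the
plane over \<open>K\<close>. By sharp transitivity an element of \<open>G\<close> that fixes one point is the identity.
Every \<open>g \<in> G\<close> turns out to fix a point, so \<open>G\<close> is trivial, and a trivial group cannot move one of
the points of the plane to another.

By the fundamental theorem of projective geometry (\<open>automorphism_PG2_semilinear\<close>) \<open>g\<close> is induced by
an injective map \<open>F\<close> of \<open>K\<^sup>3\<close> that is semilinear over a field endomorphism \<open>\<sigma>\<close>. A fixed point is found
in three steps.

\<^item> The plane is locally finite. The coordinates of the images of the three basis vectors lie in a
finite subfield \<open>k\<close>, and \<open>\<sigma>\<close> maps \<open>k\<close> into itself, so \<open>F\<close> preserves \<open>k\<^sup>3\<close> and \<open>g\<close> maps the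
finitely many points with coordinates in \<open>k\<close> to each other
(\<open>semilinear_finite_invariant_set\<close>). Hence some power \<open>g\<^sup>m\<close> with \<open>m > 0\<close> fixes a point, and
therefore \<open>g\<^sup>m = 1\<close>.

\<^item> The \<open>m\<close>-th iterate of \<open>F\<close> fixes every point and is semilinear over \<open>\<sigma>\<^sup>m\<close>, which forces
\<open>\<sigma>\<^sup>m = 1\<close> (\<open>semilinear_projectively_trivial\<close>). The automorphism group of \<open>K\<close> is torsion-free
(\<open>endo_torsion_free\<close>), so \<open>\<sigma> = 1\<close>.

\<^item> Now \<open>F\<close> is linear, and over the algebraically closed field \<open>K\<close> it has an eigenvector
(\<open>linear_map_has_eigenvector\<close>). The point spanned by it is fixed by \<open>g\<close>.
\<close>

(* Formal power series and vectors share the symbol $; if both readings stay active, the number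
   of parses of a formula grows exponentially in the number of its vector components. *)
no_notation fps_nth (infixl \<open>$\<close> 75)

section \<open>Algebraic closures of prime fields\<close>

lemma type_algebra_simps:
  shows "carrier (ring_of_type_algebra :: 'k::field ring) = UNIV"
    and "\<zero>\<^bsub>ring_of_type_algebra :: 'k ring\<^esub> = 0"
    and "\<one>\<^bsub>ring_of_type_algebra :: 'k ring\<^esub> = 1"
    and "x \<otimes>\<^bsub>ring_of_type_algebra :: 'k ring\<^esub> y = x * y"
    and "x \<oplus>\<^bsub>ring_of_type_algebra :: 'k ring\<^esub> y = x + y"
  by (simp_all add: ring_of_type_algebra_def)

lemma algebraic_closure_poly_root:
  fixes q :: "'k::field poly" and F :: "'k set"
  assumes "algebraic_closure (ring_of_type_algebra :: 'k ring) F"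
    and deg_q: "Polynomial.degree q > 0"
  shows "\<exists>x. poly q x = 0"
proof -
  define L where "L = (ring_of_type_algebra :: 'k ring)"
  interpret algebraic_closure L F using assms(1) by (simp add: L_def)
  note L = type_algebra_simps[where 'k = 'k, folded L_def]
  define P where "P = rev (coeffs q)"
  have "P \<in> carrier (poly_ring L)"
    using deg_q unfolding univ_poly_def polynomial_def
    by (auto simp: P_def hd_rev last_coeffs_eq_coeff_degree L)
  moreover have "Polynomials.degree P > 0"
    using deg_q by (auto simp: P_def degree_eq_length_coeffs)
  ultimately obtain x where x: "x \<in># roots P"
    using roots_over_carrier unfolding splitted_def by fastforce
  have pow: "x [^]\<^bsub>L\<^esub> n = x ^ n" for n :: nat
    by (induction n) (auto simp: L nat_pow_Suc mult.commute)
  have "eval xs x = poly (Poly (rev xs)) x" for xs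
    by (induction xs) (auto simp: L pow Poly_append poly_monom)
  from this[of P] have "poly q x = eval P x" by (simp add: P_def)
  also have "\<dots> = 0"
    using x roots_mem_iff_is_root[OF \<open>P \<in> carrier (poly_ring L)\<close>] by (auto simp: is_root_def L)
  finally show ?thesis by blast
qed

text \<open>
An algebraic element over a finite field generates a finite field, because its simple extension is
the span of finitely many of its powers; this is the finiteness needed for that.
\<close>
lemma (in ring) finite_Span:
  assumes "finite K" shows "finite (Span K Us)"
proof (induction Us)
  case (Cons u Us)
  have "line_extension K u (Span K Us) \<subseteq> (\<lambda>(k, v). k \<otimes> u \<oplus> v) ` (K \<times> Span K Us)"
    by (force simp: line_extension_def set_add_def' r_coset_def)
  then show ?case using assms Cons by (simp add: finite_subset)
qed simp

text \<open>
The additive group of the subfield has order \<open>p\<close>, so \<open>p\<close> annihilates \<open>1\<close> by Lagrange.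
\<close>
lemma CHAR_of_prime_order_subfield:
  fixes F :: "'k::field set"
  assumes F: "subfield F (ring_of_type_algebra :: 'k ring)" and "prime p" "card F = p"
  shows "CHAR('k) = p"
proof -
  define L where "L = (ring_of_type_algebra :: 'k ring)"
  note L = type_algebra_simps[where 'k = 'k, folded L_def]
  interpret L: field L unfolding L_def by rule
  interpret F: field "L\<lparr>carrier := F\<rparr>"
    using L.subfield_iff(2) F by (simp add: L_def)
  have fin: "finite F"
    using assms(2,3) by (metis card.infinite not_prime_0)
  have pow: "x [^]\<^bsub>add_monoid (L\<lparr>carrier := F\<rparr>)\<^esub> n = of_nat n * x" for n :: nat and x
    by (induction n) (auto simp: L nat_pow_Suc algebra_simps nat_pow_def)
  let ?A = "add_monoid (L\<lparr>carrier := F\<rparr>)"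
  have "1 \<in> carrier ?A" using F.one_closed by (simp add: L)
  from group.pow_order_eq_1[OF abelian_group.a_group[OF F.abelian_group_axioms] this]
  have "(1::'k) [^]\<^bsub>?A\<^esub> Coset.order ?A = \<one>\<^bsub>?A\<^esub>" .
  moreover have "Coset.order ?A = p" using assms(3) by (simp add: Coset.order_def)
  ultimately have "1 [^]\<^bsub>?A\<^esub> p = (0::'k)" by (simp add: L)
  then have "of_nat p = (0::'k)" using pow[of 1 p] by simp
  then have "CHAR('k) dvd p" by (simp add: of_nat_eq_0_iff_char_dvd)
  then show ?thesis
    using \<open>prime p\<close> CHAR_not_1 by (metis One_nat_def prime_nat_iff)
qed

text \<open>
The properties of an algebraic closure of a prime field that the proof uses, in terms of type class
arithmetic. The last assumption expresses algebraicity over the prime field: each element lies in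
some finite field \<open>{x. x ^ (p ^ n) = x}\<close>. The type argument only ties the type
\<open>'k\<close> to the locale.
\<close>
locale prime_field_closure =
  fixes type_of_field :: "'k::field itself" and p :: nat
  assumes prime_p: "prime p"
    and char_p: "CHAR('k) = p"
    and has_root: "\<And>q :: 'k poly. Polynomial.degree q > 0 \<Longrightarrow> \<exists>x. poly q x = 0"
    and frob_periodic: "\<And>x :: 'k. \<exists>n>0. x ^ (p ^ n) = x"

lemma (in prime_field_closure) frob_add: "(x + y :: 'k) ^ (p ^ n) = x ^ (p ^ n) + y ^ (p ^ n)"
  using freshmans_dream'[of "p ^ n" n x y] prime_p char_p by simp

lemma power_power_add: "(x :: 'a :: monoid_mult) ^ (q ^ (m + n)) = (x ^ (q ^ m)) ^ (q ^ n)"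
  by (simp add: power_add power_mult)

text \<open>
The periodicity of the Frobenius map comes from a pigeonhole argument: the iterated \<open>p\<close>-th powers of
\<open>x\<close> all lie in the finite field generated by \<open>x\<close>, so two of them agree, and since the Frobenius map
is additive with trivial kernel the common iterations can be cancelled.
\<close>
lemma prime_field_closureI:
  fixes F :: "'k::field set"
  assumes "prime p" and cl: "algebraic_closure (ring_of_type_algebra :: 'k ring) F" and "card F = p"
  shows "prime_field_closure TYPE('k) p"
proof -
  define L where "L = (ring_of_type_algebra :: 'k ring)"
  interpret algebraic_closure L F using cl by (simp add: L_def)
  have CHAR: "CHAR('k) = p"
    using CHAR_of_prime_order_subfield assms(1,3) subfield_axioms by (simp add: L_def)
  note L = type_algebra_simps[where 'k = 'k, folded L_def]
  have fin: "finite F"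
    using assms(1,3) by (metis card.infinite not_prime_0)
  have periodic: "\<exists>n>0. x ^ (p ^ n) = x" for x :: 'k
  proof -
    have alg: "(algebraic over F) x" by (rule algebraic_extension) (simp add: L)
    define E where "E = simple_extension F x"
    have subr: "subring E L"
      unfolding E_def using simple_extension_is_subring[OF subfieldE(1)[OF subfield_axioms]] L by simp
    have "finite E"
      unfolding E_def using Span_exp_base[OF subfield_axioms _ alg] finite_Span[OF fin] L by (metis UNIV_I)
    have "x \<in> E"
      unfolding E_def using simple_extension_mem[OF subfieldE(1)[OF subfield_axioms]] L by simp
    have pow: "x ^ Suc n \<in> E" for n
      by (induction n) (use \<open>x \<in> E\<close> subringE(6)[OF subr] in \<open>auto simp: L\<close>)
    have "x ^ (p ^ n) \<in> E" for n
      using pow[of "p ^ n - 1"] assms(1) by (simp add: prime_gt_0_nat)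
    then have "\<not> inj (\<lambda>n. x ^ (p ^ n))"
      using \<open>finite E\<close> by (meson finite_imageD image_subsetI infinite_UNIV_nat rev_finite_subset)
    then obtain i j where ij: "i < j" "x ^ (p ^ i) = x ^ (p ^ j)"
      unfolding inj_on_def by (metis linorder_neqE_nat)
    have frob: "(u + v :: 'k) ^ (p ^ i) = u ^ (p ^ i) + v ^ (p ^ i)" for u v
      using freshmans_dream'[of "p ^ i" i u v] assms(1) CHAR by simp
    have "x ^ (p ^ j) = (x ^ (p ^ (j - i))) ^ (p ^ i)"
      using power_power_add[of x p "j - i" i] ij by simp
    then have "x ^ (p ^ i) = (x ^ (p ^ (j - i))) ^ (p ^ i)" using ij by simp
    then have "(x - x ^ (p ^ (j - i))) ^ (p ^ i) = 0"
      using frob[of "x - x ^ (p ^ (j - i))" "x ^ (p ^ (j - i))"] by simp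
    then have "x ^ (p ^ (j - i)) = x" by simp
    then show ?thesis using ij by (intro exI[of _ "j - i"]) simp
  qed
  show ?thesis
    by unfold_locales (use assms(1) CHAR algebraic_closure_poly_root[OF cl] periodic in auto)
qed

section \<open>Finite subfields\<close>

text \<open>
Linear factors can be split off one at a time; a repeated root would be a root of the derivative.
\<close>
lemma card_roots_separable:
  fixes q :: "'k::field poly"
  assumes root: "\<And>q :: 'k poly. Polynomial.degree q > 0 \<Longrightarrow> \<exists>x. poly q x = 0"
    and "q \<noteq> 0" and sep: "\<And>x. poly q x = 0 \<Longrightarrow> poly (pderiv q) x \<noteq> 0"
  shows "card {x. poly q x = 0} = Polynomial.degree q"
  using assms(2,3)
proof (induction "Polynomial.degree q" arbitrary: q)
  case 0
  then obtain c where c: "q = [:c:]" by (metis degree_eq_zeroE)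
  with 0 have "c \<noteq> 0" by auto
  then show ?case by (simp add: c)
next
  case (Suc n)
  then obtain a where a: "poly q a = 0" using root by fastforce
  then obtain r where q: "q = [:- a, 1:] * r" by (metis dvdE poly_eq_0_iff_dvd)
  have r0: "r \<noteq> 0" using q Suc.prems by auto
  have deg: "Polynomial.degree q = Suc (Polynomial.degree r)"
    unfolding q using r0 by (subst degree_mult_eq) auto
  have ra: "poly r a \<noteq> 0"
    using Suc.prems(2)[OF a] unfolding q by (auto simp: pderiv_mult simp del: mult_pCons_left)
  have "card {x. poly r x = 0} = Polynomial.degree r"
  proof (rule Suc.hyps(1))
    show "n = Polynomial.degree r" using Suc.hyps deg by simp
    fix x assume x: "poly r x = 0"
    then have "poly q x = 0" by (simp add: q)
    from Suc.prems(2)[OF this] x show "poly (pderiv r) x \<noteq> 0"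
      unfolding q by (auto simp: pderiv_mult simp del: mult_pCons_left)
  qed (rule r0)
  moreover have "{x. poly q x = 0} = insert a {x. poly r x = 0}" by (auto simp: q)
  moreover have "finite {x. poly r x = 0}" using r0 by (rule poly_roots_finite)
  ultimately show ?case using ra deg by simp
qed

context prime_field_closure
begin

text \<open>
For \<open>n > 0\<close> this is the subfield with \<open>p ^ n\<close> elements. For \<open>n = 0\<close> it is the whole field, which
fits the divisibility order in \<open>finite_subfield_mono\<close>: every number divides \<open>0\<close>.
\<close>
definition finite_subfield :: "nat \<Rightarrow> 'k set" where
  "finite_subfield n = {x. x ^ (p ^ n) = x}"

lemma p_gt_1: "p > 1" using prime_p by (rule prime_gt_1_nat)

lemma frob_uminus: "(- x :: 'k) ^ (p ^ n) = - (x ^ (p ^ n))"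
  using frob_add[of x "- x" n] p_gt_1 by (simp add: eq_neg_iff_add_eq_0 add.commute power_0_left)

text \<open>
The polynomial \<open>X ^ (p ^ n) - X\<close> is separable, as its derivative is \<open>- 1\<close>.
\<close>
lemma card_finite_subfield:
  assumes "n > 0" shows "card (finite_subfield n) = p ^ n"
proof -
  define q where "q = Polynomial.monom 1 (p ^ n) - ([:0, 1:] :: 'k poly)"
  have pn: "p ^ n > 1" using assms p_gt_1 by (metis one_less_power)
  have "Polynomial.coeff q (p ^ n) = 1"
    using pn unfolding q_def
    by (cases "p ^ n") (auto simp: coeff_pCons split: nat.splits simp del: nat_power_eq_Suc_0_iff)
  then have q0: "q \<noteq> 0" by auto
  have deg: "Polynomial.degree q = p ^ n"
  proof (rule antisym)
    show "Polynomial.degree q \<le> p ^ n"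
      unfolding q_def using pn by (intro degree_diff_le) (auto simp: Polynomial.degree_monom_eq)
  qed (rule le_degree, simp add: \<open>Polynomial.coeff q (p ^ n) = 1\<close>)
  have "(of_nat (p ^ n) :: 'k) = 0"
    using assms char_p by (simp add: of_nat_eq_0_iff_char_dvd)
  then have "pderiv q = - 1"
    by (simp del: of_nat_power add: q_def pderiv_diff pderiv_monom pderiv_pCons one_pCons)
  then have "card {x. poly q x = 0} = Polynomial.degree q"
    by (intro card_roots_separable has_root q0) auto
  moreover have "{x. poly q x = 0} = finite_subfield n"
    by (auto simp: q_def finite_subfield_def poly_monom)
  ultimately show ?thesis using deg by simp
qed

lemma finite_finite_subfield: "n > 0 \<Longrightarrow> finite (finite_subfield n)"
  using card_finite_subfield p_gt_1 by (metis card.infinite power_not_zero not_one_less_zero)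

lemma finite_subfield_closed:
  "0 \<in> finite_subfield n" "1 \<in> finite_subfield n"
  "x \<in> finite_subfield n \<Longrightarrow> y \<in> finite_subfield n \<Longrightarrow> x + y \<in> finite_subfield n"
  "x \<in> finite_subfield n \<Longrightarrow> y \<in> finite_subfield n \<Longrightarrow> x * y \<in> finite_subfield n"
  "x \<in> finite_subfield n \<Longrightarrow> - x \<in> finite_subfield n"
  "x \<in> finite_subfield n \<Longrightarrow> inverse x \<in> finite_subfield n"
  using p_gt_1 by (auto simp: finite_subfield_def frob_add frob_uminus power_mult_distrib
      power_0_left power_inverse)

lemma finite_subfield_mono:
  assumes "m dvd n" shows "finite_subfield m \<subseteq> finite_subfield n"
proof
  fix x assume x: "x \<in> finite_subfield m"
  have "x ^ (p ^ (m * k)) = x" for k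
    by (induction k) (use x in \<open>auto simp: power_power_add finite_subfield_def\<close>)
  then show "x \<in> finite_subfield n" using assms by (auto simp: finite_subfield_def)
qed

text \<open>
The finite subfields are directed: those with exponents \<open>m\<close> and \<open>n\<close> are both contained in the one
with exponent \<open>m * n\<close>.
\<close>
lemma ex_finite_subfield:
  assumes "finite S" shows "\<exists>n>0. S \<subseteq> finite_subfield n"
  using assms
proof induction
  case (insert x S)
  then obtain n where n: "n > 0" "S \<subseteq> finite_subfield n" by blast
  obtain m where m: "m > 0" "x \<in> finite_subfield m"
    using frob_periodic by (auto simp: finite_subfield_def)
  have "insert x S \<subseteq> finite_subfield (m * n)"
    using n m finite_subfield_mono[of m "m * n"] finite_subfield_mono[of n "m * n"] by auto
  then show ?case using n m by (intro exI[of _ "m * n"]) auto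
qed auto

text \<open>
The multiplicative group of a finite field is cyclic. A generator lets a single element control an
endomorphism on the whole finite subfield.
\<close>
lemma finite_subfield_generator:
  assumes "n > 0"
  obtains z where "z \<in> finite_subfield n" "\<And>x. x \<in> finite_subfield n \<Longrightarrow> x \<noteq> 0 \<Longrightarrow> \<exists>i. x = z ^ i"
proof -
  define L where "L = (ring_of_type_algebra :: 'k ring)"
  note L = type_algebra_simps[where 'k = 'k, folded L_def]
  interpret L: field L unfolding L_def by rule
  define E where "E = finite_subfield n"
  have minus: "\<ominus>\<^bsub>L\<^esub> x = - x" for x
    by (rule L.minus_equality) (auto simp: L)
  have inv: "inv\<^bsub>L\<^esub> x = inverse x" if "x \<noteq> 0" for x
    by (rule L.comm_inv_char) (use that in \<open>auto simp: L\<close>)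
  have "subfield E L"
  proof (rule L.subfieldI')
    show "subring E L"
      by (rule L.subringI) (auto simp: E_def L minus finite_subfield_closed)
  qed (auto simp: E_def L inv finite_subfield_closed)
  then interpret E: field "L\<lparr>carrier := E\<rparr>" by (rule L.subfield_iff(2))
  have pow: "x [^]\<^bsub>L\<lparr>carrier := E\<rparr>\<^esub> i = x ^ i" for x and i :: nat
    by (induction i) (auto simp: L nat_pow_def mult.commute)
  obtain z where z: "z \<in> E - {0}" "E - {0} = {z [^]\<^bsub>L\<lparr>carrier := E\<rparr>\<^esub> i |i::nat. True}"
    using E.finite_field_mult_group_has_gen finite_finite_subfield[OF assms]
    by (auto simp: L E_def carrier_mult_of)
  show ?thesis
  proof (rule that[of z])
    show "z \<in> finite_subfield n" using z(1) by (simp add: E_def)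
    fix x assume "x \<in> finite_subfield n" "x \<noteq> 0"
    then have "x \<in> E - {0}" by (simp add: E_def)
    then show "\<exists>i. x = z ^ i" unfolding z(2) pow by blast
  qed
qed

lemma of_nat_image_eq_prime_subfield: "finite_subfield 1 = of_nat ` {..<p}"
proof (rule sym, rule card_subset_eq)
  have fix_nat: "(of_nat i :: 'k) ^ p = of_nat i" for i
    by (induction i) (use frob_add[of 1 _ 1] p_gt_1 in \<open>auto simp: power_0_left\<close>)
  then show "of_nat ` {..<p} \<subseteq> finite_subfield 1" by (auto simp: finite_subfield_def)
  have "inj_on (of_nat :: nat \<Rightarrow> 'k) {..<p}"
    by (auto simp: inj_on_def of_nat_eq_iff_cong_CHAR char_p cong_def)
  then show "card ((of_nat :: nat \<Rightarrow> 'k) ` {..<p}) = card (finite_subfield 1)"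
    by (simp add: card_image card_finite_subfield)
qed (simp add: finite_finite_subfield)

end

section \<open>Field endomorphisms\<close>

lemma additive_zero:
  fixes h :: "'a::group_add \<Rightarrow> 'b::group_add"
  assumes "\<And>x y. h (x + y) = h x + h y" shows "h 0 = 0"
proof -
  have "h 0 + 0 = h 0 + h 0" using assms[of 0 0] by simp
  then show ?thesis by (simp only: add_left_cancel)
qed

lemma map_poly_hom_mult:
  fixes h :: "'a::comm_ring_1 \<Rightarrow> 'a"
  assumes add: "\<And>x y. h (x + y) = h x + h y" and mult: "\<And>x y. h (x * y) = h x * h y"
  shows "map_poly h (q * r) = map_poly h q * map_poly h r"
proof (rule poly_eqI)
  fix n
  have h0: "h 0 = 0" by (rule additive_zero[of h, OF add])
  have sum: "h (sum f A) = (\<Sum>i\<in>A. h (f i))" for f :: "nat \<Rightarrow> 'a" and A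
    by (induction A rule: infinite_finite_induct) (auto simp: add h0)
  show "Polynomial.coeff (map_poly h (q * r)) n = Polynomial.coeff (map_poly h q * map_poly h r) n"
    by (simp add: coeff_map_poly h0 coeff_mult sum mult)
qed

lemma poly_map_poly_hom:
  fixes h :: "'a::comm_ring_1 \<Rightarrow> 'a"
  assumes add: "\<And>x y. h (x + y) = h x + h y" and mult: "\<And>x y. h (x * y) = h x * h y"
  shows "poly (map_poly h q) (h x) = h (poly q x)"
proof -
  have h0: "h 0 = 0" by (rule additive_zero[of h, OF add])
  show ?thesis
    by (induction q) (auto simp: h0 map_poly_pCons add mult)
qed

definition field_endo :: "('k::field \<Rightarrow> 'k) \<Rightarrow> bool" where
  "field_endo \<sigma> \<longleftrightarrow> (\<forall>x y. \<sigma> (x + y) = \<sigma> x + \<sigma> y) \<and> (\<forall>x y. \<sigma> (x * y) = \<sigma> x * \<sigma> y) \<and> \<sigma> 1 = 1"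

lemma field_endo_add: "field_endo \<sigma> \<Longrightarrow> \<sigma> (x + y) = \<sigma> x + \<sigma> y"
  and field_endo_mult: "field_endo \<sigma> \<Longrightarrow> \<sigma> (x * y) = \<sigma> x * \<sigma> y"
  and field_endo_one: "field_endo \<sigma> \<Longrightarrow> \<sigma> 1 = 1"
  by (simp_all add: field_endo_def)

lemma field_endo_funpow:
  assumes "field_endo \<sigma>" shows "field_endo (\<sigma> ^^ m)"
  using assms by (induction m) (auto simp: field_endo_def)

lemma field_endo_power: "field_endo \<sigma> \<Longrightarrow> \<sigma> (x ^ n) = \<sigma> x ^ n"
  by (induction n) (auto simp: field_endo_def)

context prime_field_closure
begin

lemma finite_subfield_endo:
  assumes "field_endo \<sigma>" "x \<in> finite_subfield n" shows "\<sigma> x \<in> finite_subfield n"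
  using field_endo_power[OF assms(1), of x "p ^ n"] assms(2) by (simp add: finite_subfield_def)

text \<open>
The polynomial whose roots are the Frobenius conjugates of \<open>z\<close> is invariant under the Frobenius map,
which merely permutes its linear factors cyclically. So its coefficients lie in the prime field and
are fixed by \<open>\<sigma>\<close>, and \<open>\<sigma>\<close> sends the root \<open>z\<close> to another root.
\<close>
lemma endo_eq_frob_power:
  fixes \<sigma> :: "'k \<Rightarrow> 'k"
  assumes \<sigma>: "field_endo \<sigma>" and z: "z \<in> finite_subfield N" "N > 0"
  shows "\<exists>b<N. \<sigma> z = z ^ (p ^ b)"
proof -
  note add = field_endo_add[OF \<sigma>] and mult = field_endo_mult[OF \<sigma>] and one = field_endo_one[OF \<sigma>]
  define lin where "lin i = [:- (z ^ (p ^ i)), 1:]" for i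
  define P where "P = prod lin {..<N}"
  let ?\<phi> = "\<lambda>x::'k. x ^ p"
  have \<phi>_add: "?\<phi> (x + y) = ?\<phi> x + ?\<phi> y" for x y using frob_add[of x y 1] by simp
  have \<phi>_mult: "?\<phi> (x * y) = ?\<phi> x * ?\<phi> y" for x y by (rule power_mult_distrib)
  have \<phi>_0: "?\<phi> 0 = 0" using p_gt_1 by (simp add: power_0_left)
  have lin: "map_poly ?\<phi> (lin i) = lin (Suc i)" for i
    using frob_uminus[of "z ^ (p ^ i)" 1]
    by (simp add: lin_def map_poly_pCons \<phi>_0 power_mult[symmetric] mult.commute)
  have "map_poly ?\<phi> (prod lin {..<n}) = (\<Prod>i<n. lin (Suc i))" for n
    by (induction n) (auto simp: map_poly_hom_mult[of ?\<phi>, OF \<phi>_add \<phi>_mult] lin one_pCons map_poly_pCons \<phi>_0)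
  moreover have "(\<Prod>i<N. lin (Suc i)) = prod lin {..<N}"
  proof -
    \<comment> \<open>Both sides are the product over all indices up to \<open>N\<close>.\<close>
    have "lin 0 * (\<Prod>i<N. lin (Suc i)) = lin N * prod lin {..<N}"
      by (metis prod.lessThan_Suc_shift prod.lessThan_Suc mult.commute)
    moreover have "lin N = lin 0" using z by (simp add: lin_def finite_subfield_def)
    moreover have "lin 0 \<noteq> 0" by (simp add: lin_def)
    ultimately show ?thesis by (metis mult_cancel_left)
  qed
  ultimately have P: "map_poly ?\<phi> P = P" by (simp add: P_def)
  have \<sigma>0: "\<sigma> 0 = 0" by (rule additive_zero[of \<sigma>, OF add])
  have "\<sigma> (Polynomial.coeff P i) = Polynomial.coeff P i" for i
  proof -
    have "Polynomial.coeff P i ^ p = Polynomial.coeff P i"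
      by (metis P coeff_map_poly \<phi>_0)
    then have "Polynomial.coeff P i \<in> finite_subfield 1" by (simp add: finite_subfield_def)
    then obtain j where "Polynomial.coeff P i = of_nat j"
      unfolding of_nat_image_eq_prime_subfield by blast
    moreover have "\<sigma> (of_nat j) = of_nat j" for j
      by (induction j) (auto simp: add one \<sigma>0)
    ultimately show ?thesis by simp
  qed
  then have "map_poly \<sigma> P = P" by (intro poly_eqI) (simp add: coeff_map_poly \<sigma>0)
  moreover have "poly P z = 0"
    using z(2) unfolding P_def poly_prod by (intro prod_zero) (auto simp: lin_def intro!: bexI[of _ 0])
  ultimately have "poly P (\<sigma> z) = 0"
    using poly_map_poly_hom[of \<sigma> P z, OF add mult] \<sigma>0 by simp
  then show ?thesis
    by (auto simp: P_def poly_prod lin_def)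
qed

text \<open>
On a finite field with \<open>p ^ N\<close> elements \<open>\<sigma>\<close> is the \<open>b\<close>-th power of the Frobenius map, which has
order \<open>N\<close> there, so \<open>\<sigma>\<^sup>m = 1\<close> implies that \<open>N\<close> divides \<open>b * m\<close>. If \<open>x\<close> lies in the field with
\<open>p ^ n\<close> elements, then passing to the larger field with \<open>N = n * m\<close> yields that \<open>n\<close> divides \<open>b\<close>,
and then the \<open>b\<close>-th power of the Frobenius map fixes \<open>x\<close>.
\<close>
theorem endo_torsion_free:
  fixes \<sigma> :: "'k \<Rightarrow> 'k"
  assumes \<sigma>: "field_endo \<sigma>" and m: "m > 0" "\<And>x. (\<sigma> ^^ m) x = x"
  shows "\<sigma> x = x"
proof -
  obtain n where n: "n > 0" "x \<in> finite_subfield n"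
    using frob_periodic by (auto simp: finite_subfield_def)
  define N where "N = n * m"
  have N: "N > 0" using n m by (simp add: N_def)
  obtain z where z: "z \<in> finite_subfield N"
    "\<And>y. y \<in> finite_subfield N \<Longrightarrow> y \<noteq> 0 \<Longrightarrow> \<exists>i. y = z ^ i"
    using finite_subfield_generator[OF N] by blast
  obtain b where b: "\<sigma> z = z ^ (p ^ b)"
    using endo_eq_frob_power[OF \<sigma> z(1) N] by blast
  have \<sigma>_eq: "\<sigma> y = y ^ (p ^ b)" if y: "y \<in> finite_subfield N" for y
  proof (cases "y = 0")
    case True
    then show ?thesis using additive_zero[of \<sigma>, OF field_endo_add[OF \<sigma>]] p_gt_1 by (simp add: power_0_left)
  next
    case False
    then obtain i where "y = z ^ i" using z(2)[OF y] by blast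
    then show ?thesis by (simp add: field_endo_power[OF \<sigma>] b power_mult[symmetric] mult.commute)
  qed
  have iter: "(\<sigma> ^^ j) y = y ^ (p ^ (b * j))" if y: "y \<in> finite_subfield N" for y j
    by (induction j) (auto simp: field_endo_power[OF \<sigma>] \<sigma>_eq[OF y] power_mult[symmetric] power_add mult.commute)
  \<comment> \<open>The \<open>c\<close>-th Frobenius power is trivial on the field with \<open>p ^ N\<close> elements, but for \<open>0 < c < N\<close> it has\<close>
  \<comment> \<open>too few fixed points.\<close>
  define c where "c = b * m mod N"
  have "finite_subfield N \<subseteq> finite_subfield c"
  proof
    fix y assume y: "y \<in> finite_subfield N"
    have "y = y ^ (p ^ (N * (b * m div N) + c))"
      using iter[OF y, of m] m by (simp add: c_def)
    also have "\<dots> = (y ^ (p ^ (N * (b * m div N)))) ^ (p ^ c)" by (rule power_power_add)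
    also have "y ^ (p ^ (N * (b * m div N))) = y"
      using y finite_subfield_mono[of N "N * (b * m div N)"] by (auto simp: finite_subfield_def)
    finally show "y \<in> finite_subfield c" by (simp add: finite_subfield_def)
  qed
  have "c = 0"
  proof (rule ccontr)
    assume "c \<noteq> 0"
    then have "p ^ N \<le> p ^ c"
      using card_mono[OF finite_finite_subfield \<open>finite_subfield N \<subseteq> finite_subfield c\<close>]
        card_finite_subfield N by simp
    then have "N \<le> c" using p_gt_1 by (simp add: power_increasing_iff)
    moreover have "c < N" unfolding c_def using N by (rule mod_less_divisor)
    ultimately show False by simp
  qed
  then have "n dvd b" using m(1) unfolding c_def N_def by auto
  then have "x \<in> finite_subfield b" using n finite_subfield_mono by blast
  moreover have "x \<in> finite_subfield N" using n finite_subfield_mono[of n N] by (auto simp: N_def)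
  ultimately show ?thesis using \<sigma>_eq by (simp add: finite_subfield_def)
qed

end

section \<open>Points and collinearity in coordinates\<close>

lemma vec3_eq_0_iff: "(v :: 'k::zero ^ 3) = 0 \<longleftrightarrow> v $ 1 = 0 \<and> v $ 2 = 0 \<and> v $ 3 = 0"
  by (simp add: vec_eq_iff forall_3)

lemma det_rows_3:
  fixes u v w :: "'k::comm_ring_1 ^ 3"
  shows "det (vector [u, v, w] :: 'k ^ 3 ^ 3) =
    u $ 1 * (v $ 2 * w $ 3 - v $ 3 * w $ 2) - u $ 2 * (v $ 1 * w $ 3 - v $ 3 * w $ 1)
    + u $ 3 * (v $ 1 * w $ 2 - v $ 2 * w $ 1)"
  by (simp add: det_3 algebra_simps)

lemma rows_vector_3: "rows (vector [u, v, w] :: 'k::zero ^ 3 ^ 3) = {u, v, w}"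
proof -
  have "rows A = (\<lambda>i. A $ i) ` UNIV" for A :: "'k ^ 3 ^ 3"
    by (auto simp: rows_def row_def)
  then show ?thesis by (simp only: UNIV_3 image_insert image_empty vector_3)
qed

lemma det_rows_nz_iff_span:
  fixes u v w :: "'k::field ^ 3"
  shows "det (vector [u, v, w] :: 'k ^ 3 ^ 3) \<noteq> 0 \<longleftrightarrow> vec.span {u, v, w} = UNIV"
  using matrix_left_invertible_span_rows_gen[of "vector [u, v, w] :: 'k ^ 3 ^ 3"]
  by (simp add: invertible_det_nz[symmetric] invertible_left_inverse rows_vector_3)

text \<open>
A basis of the span of \<open>S\<close> has at most two elements and extends to a basis of the whole space, from
which a two-element set in between can be picked.
\<close>
lemma subset_of_2_dim_subspace:
  fixes S :: "('k::field ^ 3) set"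
  assumes "vec.span S \<noteq> UNIV"
  shows "\<exists>V. vec.subspace V \<and> vec.dim V = 2 \<and> S \<subseteq> V"
proof -
  obtain B where B: "B \<subseteq> S" "vec.independent B" "S \<subseteq> vec.span B" "card B = vec.dim S"
    using vec.basis_exists by blast
  obtain C where C: "B \<subseteq> C" "vec.independent C" "UNIV \<subseteq> vec.span C"
    by (rule vec.maximal_independent_subset_extend[of B UNIV]) (use B(2) in auto)
  have finC: "finite C" using C(2) by (rule vec.finiteI_independent)
  have cC: "card C = 3"
    using vec.dim_eq_card[of C UNIV] C vec_dim_card[where 'a = 'k and 'n = 3] by (simp add: top.extremum_unique)
  have "B \<noteq> C"
  proof
    assume "B = C"
    then have "vec.span C \<subseteq> vec.span S" using vec.span_mono[OF B(1)] by simp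
    with C(3) assms show False by (simp add: top.extremum_unique)
  qed
  then have "card B < card C" using psubset_card_mono[OF finC] C(1) by (simp add: psubset_eq)
  then have "card B \<le> 2" using cC by simp
  then obtain D where D: "B \<subseteq> D" "D \<subseteq> C" "card D = 2"
    using exists_subset_between[of B 2 C] C(1) finC cC by auto
  have "vec.independent D" using C(2) D(2) vec.independent_mono by blast
  then have "vec.dim (vec.span D) = 2" using D(3) by (simp add: vec.dim_span vec.dim_eq_card_independent)
  then show ?thesis
    using B(3) D(1) vec.span_mono[of B D] by (intro exI[of _ "vec.span D"]) auto
qed

text \<open>
Collinearity of the three points spanned by the vectors becomes a polynomial equation.
\<close>
lemma coplanar_iff_det:
  fixes u v w :: "'k::field ^ 3"
  shows "(\<exists>V. vec.subspace V \<and> vec.dim V = 2 \<and> {u, v, w} \<subseteq> V) \<longleftrightarrow> det (vector [u, v, w] :: 'k ^ 3 ^ 3) = 0"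
proof
  assume "\<exists>V. vec.subspace V \<and> vec.dim V = 2 \<and> {u, v, w} \<subseteq> V"
  then obtain V where V: "vec.subspace V" "vec.dim V = 2" "{u, v, w} \<subseteq> V" by blast
  then have "vec.span {u, v, w} \<subseteq> V" by (intro vec.span_minimal)
  moreover have "V \<noteq> UNIV" using V(2) vec_dim_card[where 'a = 'k and 'n = 3] by auto
  ultimately show "det (vector [u, v, w] :: 'k ^ 3 ^ 3) = 0"
    using det_rows_nz_iff_span by blast
next
  assume "det (vector [u, v, w] :: 'k ^ 3 ^ 3) = 0"
  then show "\<exists>V. vec.subspace V \<and> vec.dim V = 2 \<and> {u, v, w} \<subseteq> V"
    by (intro subset_of_2_dim_subspace) (use det_rows_nz_iff_span in blast)
qed

lemma points_PG2: "points (PG2 :: (('k::field ^ 3) set, ('k ^ 3) set) incidence_structure) =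
    {vec.span {v} |v. v \<noteq> 0}"
proof (intro equalityI subsetI)
  fix x assume "x \<in> points (PG2 :: (('k ^ 3) set, ('k ^ 3) set) incidence_structure)"
  then have x: "vec.subspace x" "vec.dim x = 1" by (simp_all add: PG2_def)
  obtain B where B: "B \<subseteq> x" "vec.independent B" "x \<subseteq> vec.span B" "card B = 1"
    using vec.basis_exists[of x] x(2) by metis
  then obtain v where v: "B = {v}" by (auto simp: card_1_singleton_iff)
  have "x = vec.span {v}"
    using B x(1) unfolding v by (metis equalityI vec.span_minimal)
  moreover have "v \<noteq> 0" using B(2) v vec.dependent_zero by auto
  ultimately show "x \<in> {vec.span {v} |v. v \<noteq> 0}" by blast
next
  fix x :: "('k ^ 3) set" assume "x \<in> {vec.span {v} |v. v \<noteq> 0}"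
  then obtain v where v: "x = vec.span {v}" "v \<noteq> 0" by blast
  have "vec.independent {v}" using v(2) by simp
  then have "vec.dim x = 1" unfolding v by (simp add: vec.dim_span vec.dim_eq_card_independent)
  then show "x \<in> points PG2" by (simp add: PG2_def v)
qed

lemma span_singleton_eqE:
  fixes u v :: "'k::field ^ 3"
  assumes "vec.span {u} = vec.span {v}" "u \<noteq> 0"
  obtains c where "c \<noteq> 0" "u = c *s v"
proof -
  have "u \<in> vec.span {v}" using assms(1) vec.span_base by blast
  then obtain c where "u = c *s v" by (auto simp: vec.span_singleton)
  with assms(2) show ?thesis by (intro that[of c]) auto
qed

lemma span_singleton_smult:
  fixes v :: "'k::field ^ 3"
  assumes "c \<noteq> 0" shows "vec.span {c *s v} = vec.span {v}"
proof -
  have "v = (1 / c) *s (c *s v)" using assms by simp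
  then have "v \<in> vec.span {c *s v}"
    by (metis vec.span_scale vec.span_base singletonI)
  moreover have "c *s v \<in> vec.span {v}"
    by (intro vec.span_scale vec.span_base) simp
  ultimately show ?thesis by (simp add: vec.span_eq)
qed

text \<open>
All that is used about a collineation from here on: in coordinates it preserves the vanishing of
determinants, in both directions because it permutes the lines.
\<close>
lemma automorphism_PG2_det:
  fixes f :: "('k::field ^ 3) set \<Rightarrow> ('k ^ 3) set"
  assumes f: "f \<in> automorphisms PG2" and nz: "u \<noteq> 0" "v \<noteq> 0" "w \<noteq> 0"
    and im: "f (vec.span {u}) = vec.span {u'}" "f (vec.span {v}) = vec.span {v'}" "f (vec.span {w}) = vec.span {w'}"
  shows "det (vector [u', v', w'] :: 'k ^ 3 ^ 3) = 0 \<longleftrightarrow> det (vector [u, v, w] :: 'k ^ 3 ^ 3) = 0"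
proof -
  let ?L = "{V :: ('k ^ 3) set. vec.subspace V \<and> vec.dim V = 2}"
  obtain g where g: "bij_betw g ?L ?L"
    and gf: "\<forall>x\<in>points PG2. \<forall>V\<in>?L. f x \<subseteq> g V \<longleftrightarrow> x \<subseteq> V"
    using f by (auto simp: automorphisms_def PG2_def)
  have inc: "f (vec.span {x}) \<subseteq> g V \<longleftrightarrow> vec.span {x} \<subseteq> V" if "x \<noteq> 0" "V \<in> ?L" for x V
    using gf that unfolding points_PG2 by blast
  have sub: "vec.span {x} \<subseteq> V \<longleftrightarrow> x \<in> V" if "V \<in> ?L" for x V
    using that vec.span_base[of x "{x}"] vec.span_minimal[of "{x}" V] by auto
  have *: "{u', v', w'} \<subseteq> g V \<longleftrightarrow> {u, v, w} \<subseteq> V" if V: "V \<in> ?L" for V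
  proof -
    have gV: "g V \<in> ?L" using g V bij_betwE by blast
    show ?thesis
      using inc[OF nz(1) V] inc[OF nz(2) V] inc[OF nz(3) V]
      unfolding im sub[OF V] sub[OF gV] by simp
  qed
  have "(\<exists>V\<in>?L. {u', v', w'} \<subseteq> V) \<longleftrightarrow> (\<exists>V\<in>?L. {u', v', w'} \<subseteq> g V)"
    by (subst (1) bij_betw_imp_surj_on[OF g, symmetric]) (simp only: bex_simps)
  also have "\<dots> \<longleftrightarrow> (\<exists>V\<in>?L. {u, v, w} \<subseteq> V)" by (rule bex_cong[OF refl *])
  finally show ?thesis unfolding coplanar_iff_det[symmetric] by auto
qed

section \<open>Collineations are semilinear\<close>

definition semilinear :: "('k::field \<Rightarrow> 'k) \<Rightarrow> ('k ^ 3 \<Rightarrow> 'k ^ 3) \<Rightarrow> bool" where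
  "semilinear \<sigma> F \<longleftrightarrow> (\<forall>u v. F (u + v) = F u + F v) \<and> (\<forall>c v. F (c *s v) = \<sigma> c *s F v)"

text \<open>
The fundamental theorem of projective geometry for a collineation fixing the standard frame, where
\<open>r\<close> picks a representing vector of each image point. The lines through the vertices of the
triangle of reference carry the pairwise ratios of the coordinates, so \<open>r\<close> preserves equality of
these ratios. The action on the ratio of the first and third coordinates defines \<open>\<sigma>\<close>, and the fixed
point \<open>(1, 1, 1)\<close> makes the other ratios transform by the same \<open>\<sigma>\<close>. In the affine chart \<open>z = 1\<close>
the lines \<open>y = m x\<close> then give multiplicativity, and the lines of slope \<open>1\<close> give additivity.
\<close>
lemma normalized_collineation:
  fixes r :: "'k::field ^ 3 \<Rightarrow> 'k ^ 3"
  assumes nz: "\<And>v. v \<noteq> 0 \<Longrightarrow> r v \<noteq> 0"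
    and det: "\<And>u v w. u \<noteq> 0 \<Longrightarrow> v \<noteq> 0 \<Longrightarrow> w \<noteq> 0 \<Longrightarrow>
      det (vector [r u, r v, r w] :: 'k ^ 3 ^ 3) = 0 \<longleftrightarrow> det (vector [u, v, w] :: 'k ^ 3 ^ 3) = 0"
    and e1: "r (vector [1, 0, 0]) = vector [a, 0, 0]"
    and e2: "r (vector [0, 1, 0]) = vector [0, b, 0]"
    and e3: "r (vector [0, 0, 1]) = vector [0, 0, c]"
    and e: "r (vector [1, 1, 1]) = vector [d, d, d]"
  obtains \<sigma> where "field_endo \<sigma>"
    "\<And>v. v \<noteq> 0 \<Longrightarrow> \<exists>k. k \<noteq> 0 \<and> r v = k *s (\<chi> i. \<sigma> (v $ i))"
proof -
  have fr: "a \<noteq> 0" "b \<noteq> 0" "c \<noteq> 0" "d \<noteq> 0"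
    using nz[of "vector [1, 0, 0]"] nz[of "vector [0, 1, 0]"] nz[of "vector [0, 0, 1]"] nz[of "vector [1, 1, 1]"]
    by (auto simp: e1 e2 e3 e vec3_eq_0_iff)
  \<comment> \<open>The sides of the triangle of reference are preserved.\<close>
  have z1: "r v $ 1 = 0 \<longleftrightarrow> v $ 1 = 0" and z2: "r v $ 2 = 0 \<longleftrightarrow> v $ 2 = 0" and z3: "r v $ 3 = 0 \<longleftrightarrow> v $ 3 = 0"
    if "v \<noteq> 0" for v
    using det[of "vector [0, 1, 0]" "vector [0, 0, 1]" v] det[of "vector [1, 0, 0]" "vector [0, 0, 1]" v]
      det[of "vector [1, 0, 0]" "vector [0, 1, 0]" v] fr that
    by (simp_all add: e1 e2 e3 det_rows_3 vec3_eq_0_iff)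
  \<comment> \<open>The lines through the three vertices of the triangle are permuted.\<close>
  have E12: "r v $ 1 * r w $ 2 = r v $ 2 * r w $ 1 \<longleftrightarrow> v $ 1 * w $ 2 = v $ 2 * w $ 1"
    if "v \<noteq> 0" "w \<noteq> 0" for v w
    using det[of "vector [0, 0, 1]" v w] fr that by (simp add: e3 det_rows_3 vec3_eq_0_iff)
  have E13: "r v $ 1 * r w $ 3 = r v $ 3 * r w $ 1 \<longleftrightarrow> v $ 1 * w $ 3 = v $ 3 * w $ 1"
    if "v \<noteq> 0" "w \<noteq> 0" for v w
    using det[of "vector [0, 1, 0]" v w] fr that
    by (auto simp add: e2 det_rows_3 vec3_eq_0_iff)
  have E23: "r v $ 2 * r w $ 3 = r v $ 3 * r w $ 2 \<longleftrightarrow> v $ 2 * w $ 3 = v $ 3 * w $ 2"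
    if "v \<noteq> 0" "w \<noteq> 0" for v w
    using det[of "vector [1, 0, 0]" v w] fr that by (simp add: e1 det_rows_3 vec3_eq_0_iff)
  define \<sigma> where "\<sigma> = (\<lambda>x. r (vector [x, 0, 1]) $ 1 / r (vector [x, 0, 1]) $ 3)"
  have X: "r v $ 1 = \<sigma> (v $ 1 / v $ 3) * r v $ 3" if "v $ 3 \<noteq> 0" for v
  proof -
    let ?w = "vector [v $ 1 / v $ 3, 0, 1] :: 'k ^ 3"
    have "v \<noteq> 0" "?w \<noteq> 0" using that by (auto simp: vec3_eq_0_iff)
    then have "r v $ 1 * r ?w $ 3 = r v $ 3 * r ?w $ 1" "r ?w $ 3 \<noteq> 0"
      using E13[of v ?w] z3[of ?w] that by simp_all
    then show ?thesis by (simp add: \<sigma>_def nonzero_eq_divide_eq mult.commute)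
  qed
  \<comment> \<open>The line through \<open>(0, 0, 1)\<close> and \<open>(1, 1, 1)\<close> is preserved.\<close>
  have diag: "r v $ 2 = r v $ 1" if "v $ 1 = v $ 2" "v \<noteq> 0" for v
    using E12[of v "vector [1, 1, 1]"] that fr by (simp add: e vec3_eq_0_iff)
  \<comment> \<open>The second coordinate is transported to the first one along the diagonal.\<close>
  have Y: "r v $ 2 = \<sigma> (v $ 2 / v $ 3) * r v $ 3" if "v $ 3 \<noteq> 0" for v
  proof -
    let ?w = "vector [v $ 2 / v $ 3, v $ 2 / v $ 3, 1] :: 'k ^ 3"
    have v: "v \<noteq> 0" "?w \<noteq> 0" using that by (auto simp: vec3_eq_0_iff)
    have "r v $ 2 * r ?w $ 3 = r v $ 3 * r ?w $ 2"
      using E23[of v ?w] v that by simp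
    moreover have "r ?w $ 2 = \<sigma> (v $ 2 / v $ 3) * r ?w $ 3"
      using diag[of ?w] X[of ?w] v by simp
    moreover have "r ?w $ 3 \<noteq> 0" using z3[of ?w] v by simp
    ultimately show ?thesis by (simp add: mult.commute mult.left_commute)
  qed
  have \<sigma>1: "\<sigma> 1 = 1"
    using X[of "vector [1, 1, 1]"] fr by (simp add: e)
  have \<sigma>0: "\<sigma> 0 = 0"
    using X[of "vector [0, 0, 1]"] fr by (simp add: e3)
  have mult: "\<sigma> (x * y) = \<sigma> x * \<sigma> y" for x y
  proof -
    let ?v = "vector [1, y, 1] :: 'k ^ 3" and ?w = "vector [x, x * y, 1] :: 'k ^ 3"
    have nz': "?v \<noteq> 0" "?w \<noteq> 0" by (auto simp: vec3_eq_0_iff)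
    have "r ?v $ 1 * r ?w $ 2 = r ?v $ 2 * r ?w $ 1"
      using E12[OF nz'] by simp
    moreover have "r ?v $ 3 \<noteq> 0" "r ?w $ 3 \<noteq> 0" using z3[OF nz'(1)] z3[OF nz'(2)] by simp_all
    ultimately show ?thesis
      using X[of ?v] Y[of ?v] X[of ?w] Y[of ?w] by (simp add: \<sigma>1)
  qed
  have add: "\<sigma> (x + y) = \<sigma> x + \<sigma> y" for x y
  proof -
    \<comment> \<open>The affine points \<open>(x, x + y)\<close> and \<open>(0, y)\<close> and the point at infinity of the lines of slope \<open>1\<close>.\<close>
    let ?u = "vector [x, x + y, 1] :: 'k ^ 3" and ?v = "vector [0, y, 1] :: 'k ^ 3"
      and ?w = "vector [1, 1, 0] :: 'k ^ 3"
    have nz': "?u \<noteq> 0" "?v \<noteq> 0" "?w \<noteq> 0" by (auto simp: vec3_eq_0_iff)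
    have "det (vector [r ?u, r ?v, r ?w] :: 'k ^ 3 ^ 3) = 0"
      unfolding det[OF nz'] by (simp add: det_rows_3)
    moreover have "r ?u $ 3 \<noteq> 0" "r ?v $ 3 \<noteq> 0" "r ?w $ 3 = 0" "r ?w $ 1 \<noteq> 0"
      using z3[OF nz'(1)] z3[OF nz'(2)] z3[OF nz'(3)] z1[OF nz'(3)] by simp_all
    moreover have "r ?w $ 2 = r ?w $ 1" using diag[OF _ nz'(3)] by simp
    moreover have "r ?u $ 1 = \<sigma> x * r ?u $ 3" "r ?u $ 2 = \<sigma> (x + y) * r ?u $ 3"
      "r ?v $ 1 = 0" "r ?v $ 2 = \<sigma> y * r ?v $ 3"
      using X[of ?u] Y[of ?u] X[of ?v] Y[of ?v] by (simp_all add: \<sigma>0)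
    ultimately have "r ?u $ 3 * r ?v $ 3 * r ?w $ 1 * (\<sigma> (x + y) - \<sigma> x - \<sigma> y) = 0"
      by (simp add: det_rows_3 algebra_simps)
    then have "\<sigma> (x + y) - \<sigma> x - \<sigma> y = 0"
      using \<open>r ?u $ 3 \<noteq> 0\<close> \<open>r ?v $ 3 \<noteq> 0\<close> \<open>r ?w $ 1 \<noteq> 0\<close> by (simp del: right_minus_eq)
    then show ?thesis by (simp add: algebra_simps)
  qed
  have scale: "\<sigma> (x / y) * \<sigma> y = \<sigma> x" if "y \<noteq> 0" for x y
    using mult[of "x / y" y] that by simp
  have \<sigma>nz: "\<sigma> y \<noteq> 0" if "y \<noteq> 0" for y
    using scale[OF that, of 1] \<sigma>1 by auto
  have "\<exists>k. k \<noteq> 0 \<and> r v = k *s (\<chi> i. \<sigma> (v $ i))" if v: "v \<noteq> 0" for v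
  proof -
    consider "v $ 3 \<noteq> 0" | "v $ 3 = 0" "v $ 1 \<noteq> 0" | "v $ 3 = 0" "v $ 1 = 0" "v $ 2 \<noteq> 0"
      using v by (auto simp: vec3_eq_0_iff)
    then show ?thesis
    proof cases
      case 1
      then have "r v = (r v $ 3 / \<sigma> (v $ 3)) *s (\<chi> i. \<sigma> (v $ i))"
        using X[of v] Y[of v] \<sigma>nz[of "v $ 3"] scale[of "v $ 3" "v $ 1", symmetric]
          scale[of "v $ 3" "v $ 2", symmetric]
        by (simp add: vec_eq_iff forall_3)
      then show ?thesis using z3[OF v] 1 \<sigma>nz by (intro exI[of _ "r v $ 3 / \<sigma> (v $ 3)"]) auto
    next
      case 2
      let ?w = "vector [1, v $ 2 / v $ 1, 1] :: 'k ^ 3"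
      have w: "?w \<noteq> 0" by (simp add: vec3_eq_0_iff)
      have "r v $ 1 * r ?w $ 2 = r v $ 2 * r ?w $ 1" using E12[OF v w] 2 by simp
      moreover have "r ?w $ 1 = r ?w $ 3" "r ?w $ 2 = \<sigma> (v $ 2 / v $ 1) * r ?w $ 3"
        using X[of ?w] Y[of ?w] by (simp_all add: \<sigma>1)
      moreover have "r ?w $ 3 \<noteq> 0" using z3[OF w] by simp
      ultimately have "r v $ 1 * \<sigma> (v $ 2 / v $ 1) * r ?w $ 3 = r v $ 2 * r ?w $ 3"
        by (simp add: mult.assoc)
      with \<open>r ?w $ 3 \<noteq> 0\<close> have "r v $ 2 = \<sigma> (v $ 2 / v $ 1) * r v $ 1"
        by (simp add: mult.commute)
      then have "r v = (r v $ 1 / \<sigma> (v $ 1)) *s (\<chi> i. \<sigma> (v $ i))"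
        using 2 z3[OF v] \<sigma>nz[of "v $ 1"] scale[of "v $ 1" "v $ 2", symmetric]
        by (simp add: vec_eq_iff forall_3 \<sigma>0)
      then show ?thesis using z1[OF v] 2 \<sigma>nz by (intro exI[of _ "r v $ 1 / \<sigma> (v $ 1)"]) auto
    next
      case 3
      then have "r v = (r v $ 2 / \<sigma> (v $ 2)) *s (\<chi> i. \<sigma> (v $ i))"
        using z3[OF v] z1[OF v] \<sigma>nz[of "v $ 2"] by (simp add: vec_eq_iff forall_3 \<sigma>0)
      then show ?thesis using z2[OF v] 3 \<sigma>nz by (intro exI[of _ "r v $ 2 / \<sigma> (v $ 2)"]) auto
    qed
  qed
  then show ?thesis using that[of \<sigma>] add mult \<sigma>1 by (simp add: field_endo_def)
qed

lemma det_rows_matrix_mult: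
  fixes N :: "'k::comm_ring_1 ^ 3 ^ 3"
  shows "det (vector [N *v u, N *v v, N *v w] :: 'k ^ 3 ^ 3) = det N * det (vector [u, v, w] :: 'k ^ 3 ^ 3)"
proof -
  have "(vector [N *v u, N *v v, N *v w] :: 'k ^ 3 ^ 3) = vector [u, v, w] ** transpose N"
    by (simp add: vec_eq_iff forall_3 matrix_matrix_mult_def matrix_vector_mult_def transpose_def sum_3 mult.commute)
  then show ?thesis by (simp add: det_mul mult.commute)
qed

lemma automorphism_PG2_representative:
  fixes f :: "('k::field ^ 3) set \<Rightarrow> ('k ^ 3) set"
  assumes "f \<in> automorphisms PG2" "v \<noteq> 0"
  shows "\<exists>w. w \<noteq> 0 \<and> f (vec.span {v}) = vec.span {w}"
proof -
  have "vec.span {v} \<in> points PG2" using assms(2) by (auto simp: points_PG2)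
  moreover have "f \<in> Bij (points PG2)" using assms(1) by (simp add: automorphisms_def)
  ultimately have "f (vec.span {v}) \<in> points PG2" using Bij_imp_funcset by blast
  then show ?thesis by (auto simp: points_PG2)
qed

text \<open>
The images of the frame points are again in general position, so after rescaling the images of the
unit vectors a linear map \<open>Q\<close> takes the standard frame to the image frame. Composing with the
inverse of \<open>Q\<close> reduces the claim to a collineation that fixes the frame.
\<close>
theorem automorphism_PG2_semilinear:
  fixes f :: "('k::field ^ 3) set \<Rightarrow> ('k ^ 3) set"
  assumes f: "f \<in> automorphisms PG2"
  obtains \<sigma> F where "field_endo \<sigma>" "semilinear \<sigma> F"
    "\<And>v. v \<noteq> 0 \<Longrightarrow> F v \<noteq> 0" "\<And>v. v \<noteq> 0 \<Longrightarrow> f (vec.span {v}) = vec.span {F v}"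
proof -
  obtain \<rho> where \<rho>: "\<And>v. v \<noteq> 0 \<Longrightarrow> \<rho> v \<noteq> 0" "\<And>v. v \<noteq> 0 \<Longrightarrow> f (vec.span {v}) = vec.span {\<rho> v}"
    using automorphism_PG2_representative[OF f] by metis
  have det\<rho>: "det (vector [\<rho> u, \<rho> v, \<rho> w] :: 'k ^ 3 ^ 3) = 0 \<longleftrightarrow> det (vector [u, v, w] :: 'k ^ 3 ^ 3) = 0"
    if "u \<noteq> 0" "v \<noteq> 0" "w \<noteq> 0" for u v w
    using automorphism_PG2_det[OF f that \<rho>(2)[OF that(1)] \<rho>(2)[OF that(2)] \<rho>(2)[OF that(3)]] .
  let ?e1 = "vector [1, 0, 0] :: 'k ^ 3" and ?e2 = "vector [0, 1, 0] :: 'k ^ 3"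
    and ?e3 = "vector [0, 0, 1] :: 'k ^ 3" and ?e = "vector [1, 1, 1] :: 'k ^ 3"
  have nz: "?e1 \<noteq> 0" "?e2 \<noteq> 0" "?e3 \<noteq> 0" "?e \<noteq> 0" by (auto simp: vec3_eq_0_iff)
  define a b c d where "a = \<rho> ?e1" and "b = \<rho> ?e2" and "c = \<rho> ?e3" and "d = \<rho> ?e"
  have abc: "det (vector [a, b, c] :: 'k ^ 3 ^ 3) \<noteq> 0"
    and dets: "det (vector [d, b, c] :: 'k ^ 3 ^ 3) \<noteq> 0" "det (vector [a, d, c] :: 'k ^ 3 ^ 3) \<noteq> 0"
      "det (vector [a, b, d] :: 'k ^ 3 ^ 3) \<noteq> 0"
    unfolding a_def b_def c_def d_def using det\<rho> nz by (simp_all add: det_rows_3)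
  have mv: "transpose (vector [x, y, z] :: 'k ^ 3 ^ 3) *v s = s $ 1 *s x + s $ 2 *s y + s $ 3 *s z" for x y z s
    by (simp add: vec_eq_iff forall_3 matrix_vector_mult_def transpose_def sum_3 mult.commute)
  obtain t :: "'k ^ 3" where t: "d = t $ 1 *s a + t $ 2 *s b + t $ 3 *s c"
  proof -
    have "invertible (transpose (vector [a, b, c] :: 'k ^ 3 ^ 3))"
      using abc by (simp add: invertible_det_nz det_transpose)
    then obtain N where "transpose (vector [a, b, c] :: 'k ^ 3 ^ 3) ** N = mat 1"
      by (auto simp: invertible_def)
    then have "transpose (vector [a, b, c] :: 'k ^ 3 ^ 3) *v (N *v d) = d"
      by (simp add: matrix_vector_mul_assoc)
    then show thesis by (intro that[of "N *v d"]) (simp only: mv)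
  qed
  have t0: "t $ 1 \<noteq> 0" "t $ 2 \<noteq> 0" "t $ 3 \<noteq> 0"
  proof -
    show "t $ 1 \<noteq> 0"
    proof
      assume "t $ 1 = 0"
      then have "det (vector [d, b, c] :: 'k ^ 3 ^ 3) = 0" by (simp add: t det_rows_3 algebra_simps)
      then show False using dets by simp
    qed
    show "t $ 2 \<noteq> 0"
    proof
      assume "t $ 2 = 0"
      then have "det (vector [a, d, c] :: 'k ^ 3 ^ 3) = 0" by (simp add: t det_rows_3 algebra_simps)
      then show False using dets by simp
    qed
    show "t $ 3 \<noteq> 0"
    proof
      assume "t $ 3 = 0"
      then have "det (vector [a, b, d] :: 'k ^ 3 ^ 3) = 0" by (simp add: t det_rows_3 algebra_simps)
      then show False using dets by simp
    qed
  qed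
  define Q where "Q = transpose (vector [t $ 1 *s a, t $ 2 *s b, t $ 3 *s c] :: 'k ^ 3 ^ 3)"
  have "det Q = t $ 1 * t $ 2 * t $ 3 * det (vector [a, b, c] :: 'k ^ 3 ^ 3)"
    by (simp add: Q_def det_transpose det_rows_3 algebra_simps)
  then have detQ: "det Q \<noteq> 0" using t0 abc by simp
  then obtain N where N: "Q ** N = mat 1" "N ** Q = mat 1"
    using invertible_det_nz[of Q] by (auto simp: invertible_def)
  have detN: "det N \<noteq> 0" using det_mul[of Q N] N(1) by auto
  have QN: "Q *v (N *v x) = x" and NQ: "N *v (Q *v x) = x" for x
    by (simp_all add: matrix_vector_mul_assoc N)
  have Qmv: "Q *v s = s $ 1 *s (t $ 1 *s a) + s $ 2 *s (t $ 2 *s b) + s $ 3 *s (t $ 3 *s c)" for s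
    by (simp only: Q_def mv)
  have Ni: "N *v x = y" if "x = Q *v y" for x y using that NQ by simp
  define r where "r v = N *v \<rho> v" for v
  obtain \<sigma> where \<sigma>: "field_endo \<sigma>"
    and r\<sigma>: "\<And>v. v \<noteq> 0 \<Longrightarrow> \<exists>k. k \<noteq> 0 \<and> r v = k *s (\<chi> i. \<sigma> (v $ i))"
  proof (rule normalized_collineation[of r "1 / t $ 1" "1 / t $ 2" "1 / t $ 3" 1])
    show "r v \<noteq> 0" if "v \<noteq> 0" for v
      using \<rho>(1)[OF that] QN[of "\<rho> v"] by (auto simp: r_def)
    show "det (vector [r u, r v, r w] :: 'k ^ 3 ^ 3) = 0 \<longleftrightarrow> det (vector [u, v, w] :: 'k ^ 3 ^ 3) = 0"
      if "u \<noteq> 0" "v \<noteq> 0" "w \<noteq> 0" for u v w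
      using det\<rho>[OF that] detN by (simp add: r_def det_rows_matrix_mult)
    show "r ?e1 = vector [1 / t $ 1, 0, 0]" "r ?e2 = vector [0, 1 / t $ 2, 0]"
      "r ?e3 = vector [0, 0, 1 / t $ 3]" "r ?e = vector [1, 1, 1]"
      unfolding r_def a_def[symmetric] b_def[symmetric] c_def[symmetric] d_def[symmetric]
      by (rule Ni, simp add: Qmv t0 t)+
  qed (rule that)
  define F where "F v = Q *v (\<chi> i. \<sigma> (v $ i))" for v
  have \<rho>F: "\<exists>k. k \<noteq> 0 \<and> \<rho> v = k *s F v" if v: "v \<noteq> 0" for v
  proof -
    obtain k where k: "k \<noteq> 0" "r v = k *s (\<chi> i. \<sigma> (v $ i))" using r\<sigma>[OF v] by blast
    have "\<rho> v = Q *v r v" by (simp add: r_def QN)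
    then show ?thesis using k by (auto simp: F_def vec.scale)
  qed
  show thesis
  proof (rule that[of \<sigma> F])
    show "field_endo \<sigma>" by (rule \<sigma>)
    have "(\<chi> i. \<sigma> ((u + v) $ i)) = (\<chi> i. \<sigma> (u $ i)) + (\<chi> i. \<sigma> (v $ i))" for u v :: "'k ^ 3"
      by (simp add: vec_eq_iff field_endo_add[OF \<sigma>])
    moreover have "(\<chi> i. \<sigma> ((k *s v) $ i)) = \<sigma> k *s (\<chi> i. \<sigma> (v $ i))" for k and v :: "'k ^ 3"
      by (simp add: vec_eq_iff field_endo_mult[OF \<sigma>])
    ultimately show "semilinear \<sigma> F"
      by (simp add: semilinear_def F_def matrix_vector_right_distrib vec.scale)
    show "F v \<noteq> 0" if "v \<noteq> 0" for v using \<rho>F[OF that] \<rho>(1)[OF that] by auto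
    show "f (vec.span {v}) = vec.span {F v}" if "v \<noteq> 0" for v
      using \<rho>F[OF that] \<rho>(2)[OF that] span_singleton_smult by metis
  qed
qed

section \<open>Dynamics of a semilinear map\<close>

lemma vec3_expand: "(v :: 'k::semiring_1 ^ 3) =
    v $ 1 *s vector [1, 0, 0] + v $ 2 *s vector [0, 1, 0] + v $ 3 *s vector [0, 0, 1]"
  by (simp add: vec_eq_iff forall_3)

lemma semilinear_expand:
  assumes "semilinear \<sigma> F"
  shows "F v = \<sigma> (v $ 1) *s F (vector [1, 0, 0]) + \<sigma> (v $ 2) *s F (vector [0, 1, 0])
    + \<sigma> (v $ 3) *s F (vector [0, 0, 1])"
  using assms unfolding semilinear_def by (subst vec3_expand) metis

lemma semilinear_funpow:
  assumes "semilinear \<sigma> F" shows "semilinear (\<sigma> ^^ m) (F ^^ m)"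
  using assms by (induction m) (auto simp: semilinear_def)

text \<open>
Each vector is an eigenvector, and comparing the eigenvalues at \<open>e\<^sub>1\<close>, \<open>e\<^sub>2\<close> and \<open>e\<^sub>1 + x e\<^sub>2\<close> shows
that \<open>\<sigma>\<close> fixes \<open>x\<close>.
\<close>
lemma semilinear_projectively_trivial:
  fixes F :: "'k::field ^ 3 \<Rightarrow> 'k ^ 3"
  assumes \<sigma>: "\<sigma> 1 = 1" and F: "semilinear \<sigma> F" and triv: "\<And>v. v \<noteq> 0 \<Longrightarrow> vec.span {F v} = vec.span {v}"
    and nz: "\<And>v. v \<noteq> 0 \<Longrightarrow> F v \<noteq> 0"
  shows "\<sigma> x = x"
proof -
  have ev: "\<exists>c. c \<noteq> 0 \<and> F v = c *s v" if "v \<noteq> 0" for v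
    using span_singleton_eqE[OF triv[OF that] nz[OF that]] by blast
  let ?e1 = "vector [1, 0, 0] :: 'k ^ 3" and ?e2 = "vector [0, 1, 0] :: 'k ^ 3"
  obtain a where a: "a \<noteq> 0" "F ?e1 = a *s ?e1" using ev[of ?e1] by (auto simp: vec3_eq_0_iff)
  obtain b where b: "b \<noteq> 0" "F ?e2 = b *s ?e2" using ev[of ?e2] by (auto simp: vec3_eq_0_iff)
  have *: "\<sigma> y * b = a * y" for y
  proof -
    let ?v = "?e1 + y *s ?e2"
    have "?v \<noteq> 0" by (auto simp: vec3_eq_0_iff)
    then obtain c where c: "F ?v = c *s ?v" using ev by blast
    have "F ?v = a *s ?e1 + (\<sigma> y * b) *s ?e2"
      using F a b by (simp add: semilinear_def)
    with c have "c *s ?v = a *s ?e1 + (\<sigma> y * b) *s ?e2" by simp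
    from arg_cong[OF this, of "\<lambda>v. v $ 1"] arg_cong[OF this, of "\<lambda>v. v $ 2"]
    show ?thesis by simp
  qed
  have "b = a" using *[of 1] \<sigma> by simp
  then show ?thesis using *[of x] a(1) by simp
qed

context prime_field_closure
begin

lemma linear_map_has_eigenvector:
  fixes F :: "'k ^ 3 \<Rightarrow> 'k ^ 3"
  assumes F: "semilinear (\<lambda>x. x) F"
  obtains v k where "v \<noteq> 0" "F v = k *s v"
proof -
  let ?e1 = "vector [1, 0, 0] :: 'k ^ 3" and ?e2 = "vector [0, 1, 0] :: 'k ^ 3" and ?e3 = "vector [0, 0, 1] :: 'k ^ 3"
  define u v w where "u = F ?e1" and "v = F ?e2" and "w = F ?e3"
  \<comment> \<open>The characteristic polynomial of \<open>F\<close>, with leading coefficient \<open>- 1\<close>.\<close>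
  define q where "q = [:det (vector [u, v, w] :: 'k ^ 3 ^ 3),
    - (u $ 1 * v $ 2 - u $ 2 * v $ 1 + u $ 1 * w $ 3 - u $ 3 * w $ 1 + v $ 2 * w $ 3 - v $ 3 * w $ 2),
    u $ 1 + v $ 2 + w $ 3, - 1:]"
  have "Polynomial.degree q > 0" by (simp add: q_def)
  then obtain k where k: "poly q k = 0" using has_root by blast
  define A where "A = (vector [u - k *s ?e1, v - k *s ?e2, w - k *s ?e3] :: 'k ^ 3 ^ 3)"
  have "det A = poly q k"
    by (simp add: A_def q_def det_rows_3 algebra_simps power2_eq_square)
  then have "\<not> invertible (transpose A)" using k by (simp add: invertible_det_nz det_transpose)
  then obtain x where x: "transpose A *v x = 0" "x \<noteq> 0"
    using matrix_left_invertible_ker[of "transpose A"] invertible_left_inverse[of "transpose A"] by blast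
  have "F x = x $ 1 *s u + x $ 2 *s v + x $ 3 *s w"
    using semilinear_expand[OF F, of x] by (simp add: u_def v_def w_def)
  moreover have "transpose A *v x = x $ 1 *s u + x $ 2 *s v + x $ 3 *s w - k *s x"
    by (simp add: A_def vec_eq_iff forall_3 matrix_vector_mult_def transpose_def sum_3 algebra_simps)
  ultimately have "F x = k *s x" using x(1) by simp
  then show thesis using that x(2) by blast
qed

text \<open>
If a finite subfield contains the coordinates of the images of the unit vectors, then the vectors
with coordinates in that subfield are mapped to such vectors, because \<open>\<sigma>\<close> preserves every finite
subfield.
\<close>
lemma semilinear_finite_invariant_set:
  fixes f :: "('k ^ 3) set \<Rightarrow> ('k ^ 3) set"
  assumes \<sigma>: "field_endo \<sigma>" and F: "semilinear \<sigma> F" and nz: "\<And>v. v \<noteq> 0 \<Longrightarrow> F v \<noteq> 0"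
    and f: "\<And>v. v \<noteq> 0 \<Longrightarrow> f (vec.span {v}) = vec.span {F v}"
  obtains S where "finite S" "S \<noteq> {}" "S \<subseteq> points PG2" "f ` S \<subseteq> S"
proof -
  let ?e1 = "vector [1, 0, 0] :: 'k ^ 3" and ?e2 = "vector [0, 1, 0] :: 'k ^ 3" and ?e3 = "vector [0, 0, 1] :: 'k ^ 3"
  define C where "C = (\<lambda>(v, i). v $ i) ` ({F ?e1, F ?e2, F ?e3} \<times> (UNIV :: 3 set))"
  obtain n where n: "n > 0" "C \<subseteq> finite_subfield n"
    using ex_finite_subfield[of C] by (auto simp: C_def)
  define V where "V = {v :: 'k ^ 3. \<forall>i. v $ i \<in> finite_subfield n}"
  have "V \<subseteq> (\<lambda>(x, y, z). vector [x, y, z]) ` (finite_subfield n \<times> finite_subfield n \<times> finite_subfield n)"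
  proof
    fix v assume v: "v \<in> V"
    have "v = vector [v $ 1, v $ 2, v $ 3]" by (simp add: vec_eq_iff forall_3)
    with v show "v \<in> (\<lambda>(x, y, z). vector [x, y, z]) ` (finite_subfield n \<times> finite_subfield n \<times> finite_subfield n)"
      by (intro image_eqI[of _ _ "(v $ 1, v $ 2, v $ 3)"]) (auto simp: V_def)
  qed
  then have "finite V"
    using finite_finite_subfield[OF n(1)] by (meson finite_SigmaI finite_imageI finite_subset)
  have C: "F ?e1 $ i \<in> finite_subfield n" "F ?e2 $ i \<in> finite_subfield n" "F ?e3 $ i \<in> finite_subfield n" for i
    using n(2) by (auto simp: C_def)
  have FV: "F v \<in> V" if "v \<in> V" for v
    using that unfolding V_def semilinear_expand[OF F, of v]
    by (auto intro!: finite_subfield_closed finite_subfield_endo[OF \<sigma>] C)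
  define S where "S = (\<lambda>v. vec.span {v}) ` (V - {0})"
  show thesis
  proof (rule that[of S])
    show "finite S" using \<open>finite V\<close> by (simp add: S_def)
    have "?e1 \<in> V - {0}" by (simp add: V_def vec_eq_iff forall_3 finite_subfield_closed)
    then show "S \<noteq> {}" by (auto simp: S_def)
    show "S \<subseteq> points PG2" by (auto simp: S_def points_PG2)
    show "f ` S \<subseteq> S" using FV nz f by (auto simp: S_def)
  qed
qed

end

section \<open>Singer groups\<close>

text \<open>
Group elements are functions restricted to the point set, so the iterates of \<open>g\<close> agree with group
elements only on points; \<open>m = 0\<close> yields the identity.
\<close>
lemma subgroup_closed_funpow:
  assumes G: "subgroup G (automorphism_group S)" and g: "g \<in> G"
  shows "\<exists>h\<in>G. \<forall>x\<in>points S. h x = (g ^^ m) x"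
proof (induction m)
  case 0
  have "\<one>\<^bsub>automorphism_group S\<^esub> \<in> G" using subgroup.one_closed[OF G] .
  then show ?case by (intro bexI[of _ "\<one>\<^bsub>automorphism_group S\<^esub>"]) (auto simp: automorphism_group_def BijGroup_def)
next
  case (Suc m)
  then obtain h where h: "h \<in> G" "\<forall>x\<in>points S. h x = (g ^^ m) x" by blast
  have sub: "G \<subseteq> Bij (points S)"
    using subgroup.subset[OF G] by (auto simp: automorphism_group_def automorphisms_def)
  have "g \<otimes>\<^bsub>automorphism_group S\<^esub> h \<in> G" using subgroup.m_closed[OF G g h(1)] .
  moreover have "(g \<otimes>\<^bsub>automorphism_group S\<^esub> h) x = (g ^^ Suc m) x" if "x \<in> points S" for x
    using that sub g h by (auto simp: automorphism_group_def BijGroup_def compose_def)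
  ultimately show ?case by blast
qed

text \<open>
Finite invariant sets of points make \<open>g\<close> a torsion element, torsion-freeness of the automorphisms of
the field makes it linear, and an eigenvector then provides a fixed point.
\<close>
lemma (in prime_field_closure) singer_group_trivial:
  fixes G :: "(('k ^ 3) set \<Rightarrow> ('k ^ 3) set) set"
  assumes G: "singer_group PG2 G" and g: "g \<in> G" and P: "P \<in> points (PG2 :: (('k ^ 3) set, ('k ^ 3) set) incidence_structure)"
  shows "g P = P"
proof -
  let ?P = "points (PG2 :: (('k ^ 3) set, ('k ^ 3) set) incidence_structure)"
  have sub: "subgroup G (automorphism_group PG2)"
    and regular: "\<And>x y. x \<in> ?P \<Longrightarrow> y \<in> ?P \<Longrightarrow> \<exists>!g. g \<in> G \<and> g x = y"
    using G by (auto simp: singer_group_def)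
  have g_aut: "g \<in> automorphisms PG2"
    using subgroup.subset[OF sub] g by (auto simp: automorphism_group_def)
  obtain one where one: "one \<in> G" "\<And>x. x \<in> ?P \<Longrightarrow> one x = x"
    using subgroup_closed_funpow[OF sub g, of 0] by auto
  \<comment> \<open>Regularity: an element with a fixed point coincides with the identity.\<close>
  have fixes_all: "h x = x" if "h \<in> G" "x0 \<in> ?P" "h x0 = x0" "x \<in> ?P" for h x0 x
    using regular[of x0 x0] one that by metis
  obtain \<sigma> F where \<sigma>: "field_endo \<sigma>" and F: "semilinear \<sigma> F"
    and Fnz: "\<And>v. v \<noteq> 0 \<Longrightarrow> F v \<noteq> 0" and gF: "\<And>v. v \<noteq> 0 \<Longrightarrow> g (vec.span {v}) = vec.span {F v}"
    using automorphism_PG2_semilinear[OF g_aut] by blast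
  obtain S where S: "finite S" "S \<noteq> {}" "S \<subseteq> ?P" "g ` S \<subseteq> S"
    using semilinear_finite_invariant_set[OF \<sigma> F Fnz gF] by blast
  then obtain x0 where x0: "x0 \<in> S" by blast
  have iter_S: "(g ^^ i) x0 \<in> S" for i
    by (induction i) (use x0 S(4) in auto)
  then have "\<not> inj (\<lambda>i. (g ^^ i) x0)"
    using S(1) by (meson finite_imageD finite_subset image_subsetI infinite_UNIV_nat)
  then obtain i j where ij: "i < j" "(g ^^ i) x0 = (g ^^ j) x0"
    unfolding inj_on_def by (metis linorder_neqE_nat)
  define m where "m = j - i"
  have m: "m > 0" using ij by (simp add: m_def)
  obtain h where h: "h \<in> G" "\<And>x. x \<in> ?P \<Longrightarrow> h x = (g ^^ m) x"
    using subgroup_closed_funpow[OF sub g, of m] by blast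
  define y where "y = (g ^^ i) x0"
  have "(g ^^ m) y = (g ^^ (m + i)) x0" by (simp add: y_def funpow_add)
  also have "\<dots> = y" using ij by (simp add: y_def m_def)
  finally have "(g ^^ m) y = y" .
  then have gm: "(g ^^ m) x = x" if "x \<in> ?P" for x
    using fixes_all[OF h(1), of y x] h(2) that iter_S[of i] S(3) y_def by auto
  have FmNz: "(F ^^ k) v \<noteq> 0" if "v \<noteq> 0" for v k
    by (induction k) (use that Fnz in auto)
  have gFm: "(g ^^ k) (vec.span {v}) = vec.span {(F ^^ k) v}" if "v \<noteq> 0" for v k
    by (induction k) (use FmNz[OF that] gF in auto)
  have \<sigma>m: "(\<sigma> ^^ m) x = x" for x
  proof (rule semilinear_projectively_trivial)
    show "(\<sigma> ^^ m) 1 = 1" by (rule field_endo_one[OF field_endo_funpow[OF \<sigma>]])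
    show "semilinear (\<sigma> ^^ m) (F ^^ m)" by (rule semilinear_funpow[OF F])
    show "vec.span {(F ^^ m) v} = vec.span {v}" if "v \<noteq> 0" for v
    proof -
      have "vec.span {v} \<in> ?P" using that by (auto simp: points_PG2)
      then show ?thesis using gFm[OF that, of m] gm by simp
    qed
  qed (rule FmNz)
  have "\<sigma> = (\<lambda>x. x)"
    using endo_torsion_free[OF \<sigma> m \<sigma>m] by (rule ext)
  then obtain v k where v: "v \<noteq> 0" "F v = k *s v"
    using linear_map_has_eigenvector F by blast
  then have "k \<noteq> 0" using Fnz[of v] by auto
  then have "g (vec.span {v}) = vec.span {v}"
    using gF[OF v(1)] v(2) span_singleton_smult by metis
  moreover have "vec.span {v} \<in> ?P" using v(1) by (auto simp: points_PG2)
  ultimately show ?thesis using fixes_all g P by blast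
qed

theorem theorem1p3:
  fixes p :: nat and F :: "'k::field set"
  assumes "prime p"
    and "algebraic_closure (ring_of_type_algebra :: 'k ring) F"
    and "card F = p"
  shows "\<not> (\<exists>G. singer_group (PG2 :: (('k ^ 3) set, ('k ^ 3) set) incidence_structure) G)"
proof
  assume "\<exists>G. singer_group (PG2 :: (('k ^ 3) set, ('k ^ 3) set) incidence_structure) G"
  then obtain G where G: "singer_group (PG2 :: (('k ^ 3) set, ('k ^ 3) set) incidence_structure) G" ..
  interpret prime_field_closure "TYPE('k)" p by (rule prime_field_closureI[OF assms])
  let ?e1 = "vector [1, 0, 0] :: 'k ^ 3" and ?e2 = "vector [0, 1, 0] :: 'k ^ 3"
  have nz: "?e1 \<noteq> 0" "?e2 \<noteq> 0" by (simp_all add: vec_eq_iff forall_3)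
  then have pts: "vec.span {?e1} \<in> points PG2" "vec.span {?e2} \<in> points PG2" by (auto simp: points_PG2)
  then obtain g where g: "g \<in> G" "g (vec.span {?e1}) = vec.span {?e2}"
    using G unfolding singer_group_def by metis
  then have "vec.span {?e1} = vec.span {?e2}" using singer_group_trivial[OF G g(1) pts(1)] by simp
  then obtain c where "?e1 = c *s ?e2" using nz(1) by (rule span_singleton_eqE)
  from arg_cong[OF this, of "\<lambda>v. v $ 1"] show False by simp
qed

end
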